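(* Suppose $X=\{X_1,\dots,X_m\}$ and $Y=\{Y_1,\dots,Y_{m'}\}$ are $\eta$-coplanar for some $\eta\in\mathbb{R}^s$ and that they define the same directional growth function. Then $m=m'$ and $X$ is a permutation of $Y$.
   Context: Let $s\ge 1$. A finite family of integral vectors $X=\{X_1,\dots,X_m\}\subset\mathbb{Z}^s$ (repetitions allowed) is assumed to lie in an open half-space, i.e. there is $\alpha\in\mathbb{R}^s$ with $\langle X_j,\alpha\rangle>0$ for all $j$, and to span $\mathbb{R}^s$. Let $\mathbf{C}_X=X_1\mathbb{R}^++\cdots+X_m\mathbb{R}^+$ be the convex cone and $\mathcal{J}_X=X_1\mathbb{N}+\cdots+X_m\mathbb{N}$ the additive semi-group generated by $X$. For $z\in\mathcal{J}_X$, the multiplicity $\mathbf{m}_X(z)$ is the number of words $i_1\dots i_n$ over $\{1,\dots,m\}$ (any $n\ge 0$) with $X_{i_1}+\cdots+X_{i_n}=z$; for $x\in\mathbf{C}_X$ one sets $\mathbf{m}_X(x)=\min\{\mathbf{m}_X(z): z\in\mathcal{J}_X,\ \|x-z\|=d(x,\mathcal{J}_X)\}$. The directional growth function is $\gamma_X(\theta)=\lim_{k\to\infty}\frac{1}{k}\log\mathbf{m}_X(k\theta)$ for unit vectors $\theta\in\mathbf{C}_X$ (the limit exists). Two such families $X$ and $Y$ are said to define the same directional growth function if $\mathbf{C}_X=\mathbf{C}_Y$ and $\gamma_X=\gamma_Y$. The family $X$ is called $\eta$-coplanar if $\langle \eta, X_j\rangle=1$ for all $j=1,\dots,m$. *)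

theory Defs
  imports "HOL-Analysis.Analysis" "HOL-Combinatorics.Permutations"
begin

text \<open>A finite family with repetitions is a list of vectors. Integral vectors are vectors of
  \<open>real ^ 'n\<close> with integer coordinates; the dimension is \<open>CARD('n) \<ge> 1\<close>.\<close>

definition admissible_family :: "(real ^ 'n) list \<Rightarrow> bool" where
  "admissible_family X \<longleftrightarrow>
     (\<forall>x\<in>set X. \<forall>i. x $ i \<in> \<int>) \<and>
     (\<exists>\<alpha>. \<forall>x\<in>set X. x \<bullet> \<alpha> > 0) \<and>
     span (set X) = UNIV"

definition family_cone :: "(real ^ 'n) list \<Rightarrow> (real ^ 'n) set" where
  "family_cone X =
     {\<Sum>j<length X. c j *\<^sub>R X ! j | c :: nat \<Rightarrow> real. \<forall>j<length X. c j \<ge> 0}"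

definition family_semigroup :: "(real ^ 'n) list \<Rightarrow> (real ^ 'n) set" where
  "family_semigroup X =
     {\<Sum>j<length X. real (a j) *\<^sub>R X ! j | a :: nat \<Rightarrow> nat. True}"

text \<open>Words are words in the indices, so equal vectors at different positions are different
  letters. For a family in an open half-space the set of words counted is finite.\<close>

definition word_mult :: "(real ^ 'n) list \<Rightarrow> real ^ 'n \<Rightarrow> nat" where
  "word_mult X z =
     card {w :: nat list. set w \<subseteq> {..<length X} \<and> sum_list (map (\<lambda>i. X ! i) w) = z}"

text \<open>The extension of the multiplicity from the semigroup to the cone. The infimum is over a
  nonempty set of natural numbers, hence a minimum: the semigroup contains \<open>0\<close> and consists of
  integral vectors, so nearest points exist.\<close>

definition cone_mult :: "(real ^ 'n) list \<Rightarrow> real ^ 'n \<Rightarrow> nat" where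
  "cone_mult X x =
     Inf {word_mult X z | z.
            z \<in> family_semigroup X \<and> norm (x - z) = infdist x (family_semigroup X)}"

definition dir_growth :: "(real ^ 'n) list \<Rightarrow> real ^ 'n \<Rightarrow> real" where
  "dir_growth X \<theta> = lim (\<lambda>k::nat. 1 / real k * ln (real (cone_mult X (real k *\<^sub>R \<theta>))))"

text \<open>The growth function has the unit vectors of the cone as its domain.\<close>

definition same_dir_growth :: "(real ^ 'n) list \<Rightarrow> (real ^ 'n) list \<Rightarrow> bool" where
  "same_dir_growth X Y \<longleftrightarrow>
     family_cone X = family_cone Y \<and>
     (\<forall>\<theta>\<in>family_cone X. norm \<theta> = 1 \<longrightarrow> dir_growth X \<theta> = dir_growth Y \<theta>)"

definition eta_coplanar :: "real ^ 'n \<Rightarrow> (real ^ 'n) list \<Rightarrow> bool" where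
  "eta_coplanar \<eta> X \<longleftrightarrow> (\<forall>x\<in>set X. \<eta> \<bullet> x = 1)"

end

theory Submission
  imports Defs "HOL-Real_Asymp.Real_Asymp"
begin

text \<open>
  Put \<open>Z\<^sub>X(b) = \<Sum>\<^sub>j exp (b \<bullet> X\<^sub>j)\<close>. For integral families in an open half-space, the growth function
  determines the set of all \<open>b\<close> with \<open>Z\<^sub>X(b) \<le> 1\<close>. If \<open>Z\<^sub>Y(b) \<le> 1\<close>, Kraft's inequality for the words
  with sum \<open>z\<close> gives \<open>m\<^sub>Y(z) exp (b \<bullet> z) \<le> 1\<close>, hence \<open>\<gamma>\<^sub>Y(\<theta>) \<le> - b \<bullet> \<theta>\<close>. By supermultiplicativity
  of \<open>m\<^sub>X\<close> and Fekete's lemma, \<open>\<gamma>\<^sub>X\<close> exists in the relative interior of the cone, is positively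
  homogeneous and dominates \<open>ln m\<^sub>X\<close> there, and adding \<open>S = \<Sum>\<^sub>j X\<^sub>j\<close> moves the whole semigroup into
  the relative interior. So if \<open>\<gamma>\<^sub>X = \<gamma>\<^sub>Y\<close>, then \<open>m\<^sub>X(z) exp (b \<bullet> z) \<le> exp (- b \<bullet> S)\<close> for all \<open>z\<close>.
  Grouping the expansion of \<open>Z\<^sub>X(b) ^ n\<close> by the sums \<open>z\<close> of words of length \<open>n\<close>, of which there are
  polynomially many, shows that \<open>Z\<^sub>X(b) ^ n\<close> grows at most polynomially, that is, \<open>Z\<^sub>X(b) \<le> 1\<close>.

  For an \<open>\<eta>\<close>-coplanar family, \<open>Z\<^sub>X(b - t \<eta>) = exp (- t) Z\<^sub>X(b)\<close>, so that \<open>Z\<^sub>X\<close> itself is determined,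
  and an exponential sum determines its frequencies.
\<close>

subsection \<open>Superadditive functions\<close>

lemma superadditive_quotient_ge:
  fixes f :: "real \<Rightarrow> real"
  assumes "0 < a"
    and superadditive: "\<And>s t. a \<le> s \<Longrightarrow> a \<le> t \<Longrightarrow> f s + f t \<le> f (s + t)"
    and nonneg: "\<And>t. a \<le> t \<Longrightarrow> 0 \<le> f t"
    and "a \<le> t" and "a \<le> x"
  shows "((x - a) / t - 1) * f t / x \<le> f x / x"
proof (rule divide_right_mono)
  have multiples: "real q * f t + f s \<le> f (real q * t + s)" if "a \<le> s" for q s
  proof (induction q)
    case (Suc q)
    have "a \<le> real q * t + s"
      using that \<open>a \<le> t\<close> \<open>0 < a\<close> by (simp add: add_increasing)
    then have "f t + f (real q * t + s) \<le> f (t + (real q * t + s))"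
      using \<open>a \<le> t\<close> by (intro superadditive)
    with Suc show ?case
      by (simp add: algebra_simps)
  qed simp
  define q where "q = nat \<lfloor>(x - a) / t\<rfloor>"
  have q: "real q \<le> (x - a) / t" "(x - a) / t - 1 \<le> real q"
    using \<open>a \<le> x\<close> \<open>a \<le> t\<close> \<open>0 < a\<close> by (auto simp: q_def)
  then have rest: "a \<le> x - real q * t"
    using \<open>a \<le> t\<close> \<open>0 < a\<close> by (simp add: le_divide_eq)
  have "((x - a) / t - 1) * f t \<le> real q * f t"
    using q(2) nonneg[OF \<open>a \<le> t\<close>] by (rule mult_right_mono)
  also have "\<dots> \<le> f x"
    using multiples[OF rest, of q] nonneg[OF rest] by simp
  finally show "((x - a) / t - 1) * f t \<le> f x" .
qed (use \<open>a \<le> x\<close> \<open>0 < a\<close> in simp)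

lemma superadditive_quotient_tendsto_SUP:
  fixes f :: "real \<Rightarrow> real"
  assumes "0 < a"
    and superadditive: "\<And>s t. a \<le> s \<Longrightarrow> a \<le> t \<Longrightarrow> f s + f t \<le> f (s + t)"
    and nonneg: "\<And>t. a \<le> t \<Longrightarrow> 0 \<le> f t"
    and bdd: "bdd_above ((\<lambda>t. f t / t) ` {a..})"
  shows "((\<lambda>t. f t / t) \<longlongrightarrow> (SUP t\<in>{a..}. f t / t)) at_top"
proof (rule order_tendstoI)
  fix l assume "l < (SUP t\<in>{a..}. f t / t)"
  then obtain t where t: "a \<le> t" "l < f t / t"
    using less_cSUP_iff[OF _ bdd] by auto
  have lower: "((x - a) / t - 1) * f t / x \<le> f x / x" if "a \<le> x" for x
    by (rule superadditive_quotient_ge[OF \<open>0 < a\<close> superadditive nonneg t(1) that])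
  have "0 < t"
    using t(1) \<open>0 < a\<close> by simp
  then have "((\<lambda>x. ((x - a) / t - 1) * f t / x) \<longlongrightarrow> inverse t * f t) at_top"
    by real_asymp
  then have "\<forall>\<^sub>F x in at_top. l < ((x - a) / t - 1) * f t / x"
    using t(2) by (intro order_tendstoD) (auto simp: divide_inverse mult.commute)
  then show "\<forall>\<^sub>F x in at_top. l < f x / x"
    using eventually_ge_at_top[of a] by eventually_elim (use lower in force)
next
  fix u assume "(SUP t\<in>{a..}. f t / t) < u"
  then have "f x / x < u" if "a \<le> x" for x
    using cSUP_upper[OF _ bdd, of x] that by simp
  then show "\<forall>\<^sub>F x in at_top. f x / x < u"
    by (rule eventually_at_top_linorderI)
qed

lemma tendsto_quotient_at_top_unshift:
  fixes u :: "real \<Rightarrow> real"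
  assumes "((\<lambda>t. u (t - r) / t) \<longlongrightarrow> L) at_top"
  shows "((\<lambda>t. u t / t) \<longlongrightarrow> L) at_top"
proof -
  have "filterlim (\<lambda>t. t + r) at_top at_top"
    by real_asymp
  from filterlim_compose[OF assms this] have "((\<lambda>t. u t / (t + r)) \<longlongrightarrow> L) at_top"
    by simp
  moreover have "((\<lambda>t. (t + r) / t) \<longlongrightarrow> 1) at_top"
    by real_asymp
  ultimately have "((\<lambda>t. u t / (t + r) * ((t + r) / t)) \<longlongrightarrow> L * 1) at_top"
    by (rule tendsto_mult)
  moreover have "\<forall>\<^sub>F t in at_top. u t / (t + r) * ((t + r) / t) = u t / t"
    using eventually_gt_at_top[of "- r"] by eventually_elim simp
  ultimately have "((\<lambda>t. u t / t) \<longlongrightarrow> L * 1) at_top"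
    by (rule Lim_transform_eventually)
  then show ?thesis
    by simp
qed

lemma shifted_superadditive_quotient_convergent:
  fixes u :: "real \<Rightarrow> real"
  assumes "0 < r"
    and super: "\<And>s t. 0 \<le> s \<Longrightarrow> 0 \<le> t \<Longrightarrow> u s + u t \<le> u (s + t + r)"
    and nonneg: "\<And>t. 0 \<le> t \<Longrightarrow> 0 \<le> u t"
    and linear: "\<And>t. 0 \<le> t \<Longrightarrow> u t \<le> A + B * t"
  obtains L where "((\<lambda>t. u t / t) \<longlongrightarrow> L) at_top"
proof -
  have "((\<lambda>t. u (t - r) / t) \<longlongrightarrow> (SUP t\<in>{r..}. u (t - r) / t)) at_top"
  proof (rule superadditive_quotient_tendsto_SUP[OF \<open>0 < r\<close>])
    show "u (s - r) + u (t - r) \<le> u (s + t - r)" if "r \<le> s" "r \<le> t" for s t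
      using super[of "s - r" "t - r"] that by simp
    show "0 \<le> u (t - r)" if "r \<le> t" for t
      using nonneg that by simp
    show "bdd_above ((\<lambda>t. u (t - r) / t) ` {r..})"
    proof (rule bdd_aboveI2)
      fix t assume "t \<in> {r..}"
      then have "r \<le> t"
        by simp
      then have "u (t - r) \<le> \<bar>A\<bar> + \<bar>B\<bar> * (t - r)"
        using linear[of "t - r"] abs_ge_self[of A] mult_right_mono[OF abs_ge_self[of B], of "t - r"]
        by simp
      also have "\<dots> \<le> \<bar>A\<bar> / r * t + \<bar>B\<bar> * t"
        using \<open>0 < r\<close> \<open>r \<le> t\<close> mult_left_mono[of r t "\<bar>A\<bar> / r"]
        by (intro add_mono mult_left_mono) auto
      finally show "u (t - r) / t \<le> \<bar>A\<bar> / r + \<bar>B\<bar>"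
        using \<open>0 < r\<close> \<open>r \<le> t\<close> by (simp add: divide_le_eq distrib_right)
    qed
  qed
  from tendsto_quotient_at_top_unshift[OF this] show thesis
    by (rule that)
qed

subsection \<open>Exponential sums\<close>

lemma inner_less_inner_self_if_norm_le:
  fixes x y :: "'a::real_inner"
  assumes "norm x \<le> norm y" and "x \<noteq> y"
  shows "y \<bullet> x < y \<bullet> y"
proof -
  have "0 < (x - y) \<bullet> (x - y)"
    using \<open>x \<noteq> y\<close> by simp
  then have "2 * (y \<bullet> x) < x \<bullet> x + y \<bullet> y"
    by (simp add: inner_diff_left inner_diff_right inner_commute)
  moreover have "x \<bullet> x \<le> y \<bullet> y"
    using \<open>norm x \<le> norm y\<close> by (simp add: norm_le)
  ultimately show ?thesis by simp
qed

text \<open>A frequency \<open>x\<close> of maximal norm dominates the sum at \<open>b = n x\<close> as \<open>n \<rightarrow> \<infinity>\<close>.\<close>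

lemma exponentials_independent:
  fixes S :: "'a::real_inner set" and d :: "'a \<Rightarrow> real"
  assumes "finite S" and "\<And>b. (\<Sum>x\<in>S. d x * exp (b \<bullet> x)) = 0"
  shows "\<forall>x\<in>S. d x = 0"
  using assms
proof (induction S rule: finite_ranking_induct[where f = norm])
  case (insert x S)
  show ?case
  proof (cases "x \<in> S")
    case True
    then show ?thesis
      using insert by (simp add: insert_absorb)
  next
    case False
    have normalized: "d x + (\<Sum>y\<in>S. d y * exp (real n * (x \<bullet> y - x \<bullet> x))) = 0" for n
    proof -
      have "d x + (\<Sum>y\<in>S. d y * exp (real n * (x \<bullet> y - x \<bullet> x)))
          = (\<Sum>y\<in>insert x S. d y * exp ((real n *\<^sub>R x) \<bullet> y)) * exp (- (real n * (x \<bullet> x)))"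
        using False insert.hyps(1)
        by (simp add: sum_distrib_right mult.assoc right_diff_distrib distrib_right flip: exp_add)
      then show ?thesis
        by (simp only: insert.prems mult_zero_left)
    qed
    have "(\<lambda>n. d y * exp (real n * (x \<bullet> y - x \<bullet> x))) \<longlonglongrightarrow> 0" if "y \<in> S" for y
    proof -
      have "x \<bullet> y - x \<bullet> x < 0"
        using inner_less_inner_self_if_norm_le[of y x] insert.hyps(2)[OF that] that False by auto
      then show ?thesis
        by real_asymp
    qed
    then have "(\<lambda>n. d x + (\<Sum>y\<in>S. d y * exp (real n * (x \<bullet> y - x \<bullet> x)))) \<longlonglongrightarrow> d x + (\<Sum>y\<in>S. 0)"
      by (intro tendsto_intros)
    then have "d x = 0"
      by (simp add: normalized LIMSEQ_const_iff)
    moreover have "\<forall>y\<in>S. d y = 0"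
      using insert.prems False insert.hyps(1) \<open>d x = 0\<close> by (intro insert.IH) simp
    ultimately show ?thesis by simp
  qed
qed simp

lemma sum_list_map_eq_sum_count_scaleR:
  fixes f :: "'a \<Rightarrow> 'b::real_vector"
  assumes "set xs \<subseteq> A" and "finite A"
  shows "(\<Sum>x\<leftarrow>xs. f x) = (\<Sum>x\<in>A. real (count_list xs x) *\<^sub>R f x)"
  using assms(1)
proof (induction xs)
  case (Cons y xs)
  have "(\<Sum>x\<in>A. real (count_list (y # xs) x) *\<^sub>R f x)
      = (\<Sum>x\<in>A. real (count_list xs x) *\<^sub>R f x + (if x = y then f x else 0))"
    by (intro sum.cong) (auto simp: scaleR_add_left)
  also have "\<dots> = (\<Sum>x\<in>A. real (count_list xs x) *\<^sub>R f x) + f y"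
    using Cons.prems \<open>finite A\<close> by (simp add: sum.distrib)
  finally show ?case
    using Cons by simp
qed simp

definition exp_sum :: "'a::real_inner list \<Rightarrow> 'a \<Rightarrow> real" where
  "exp_sum X b = (\<Sum>x\<leftarrow>X. exp (b \<bullet> x))"

lemma exp_sum_nonneg: "0 \<le> exp_sum X b"
  unfolding exp_sum_def by (intro sum_list_nonneg) auto

lemma exp_sum_eq_sum_nth: "exp_sum X b = (\<Sum>i<length X. exp (b \<bullet> X ! i))"
  by (simp add: exp_sum_def sum_list_sum_nth atLeast0LessThan)

lemma mset_eq_if_exp_sum_eq:
  assumes "exp_sum X = exp_sum Y"
  shows "mset X = mset Y"
proof (rule multiset_eqI)
  let ?d = "\<lambda>x. real (count_list X x) - real (count_list Y x)"
  have "(\<Sum>x\<in>set X \<union> set Y. ?d x * exp (b \<bullet> x)) = 0" for b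
    using fun_cong[OF assms, of b]
    by (simp add: exp_sum_def sum_list_map_eq_sum_count_scaleR[of _ "set X \<union> set Y"]
        left_diff_distrib sum_subtractf)
  then have "\<forall>x\<in>set X \<union> set Y. ?d x = 0"
    by (intro exponentials_independent) auto
  then show "count (mset X) x = count (mset Y) x" for x
    by (cases "x \<in> set X \<union> set Y") (auto simp: count_mset count_list_0_iff)
qed

lemma exp_sum_diff_scaleR_coplanar:
  assumes "eta_coplanar \<eta> X"
  shows "exp_sum X (b - t *\<^sub>R \<eta>) = exp (- t) * exp_sum X b"
proof -
  have "exp_sum X (b - t *\<^sub>R \<eta>) = (\<Sum>x\<leftarrow>X. exp (- t) * exp (b \<bullet> x))"
    unfolding exp_sum_def using assms
    by (intro arg_cong[of _ _ sum_list] map_cong)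
      (auto simp: eta_coplanar_def inner_diff_left simp flip: exp_add)
  then show ?thesis
    by (simp add: exp_sum_def sum_list_const_mult)
qed

subsection \<open>Words\<close>

definition word_sum :: "'a::real_vector list \<Rightarrow> nat list \<Rightarrow> 'a" where
  "word_sum X w = (\<Sum>i\<leftarrow>w. X ! i)"

lemma word_sum_Nil [simp]: "word_sum X [] = 0"
  by (simp add: word_sum_def)

lemma word_sum_Cons [simp]: "word_sum X (i # w) = X ! i + word_sum X w"
  by (simp add: word_sum_def)

lemma word_sum_append [simp]: "word_sum X (v @ w) = word_sum X v + word_sum X w"
  by (simp add: word_sum_def)

lemma word_sum_eq_sum_count:
  assumes "set w \<subseteq> {..<length X}"
  shows "word_sum X w = (\<Sum>j<length X. real (count_list w j) *\<^sub>R X ! j)"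
  using assms by (simp add: word_sum_def sum_list_map_eq_sum_count_scaleR)

definition words_of_length :: "'a list \<Rightarrow> nat \<Rightarrow> nat list set" where
  "words_of_length X n = {w. set w \<subseteq> {..<length X} \<and> length w = n}"

lemma exp_sum_power_eq_sum_words:
  "exp_sum X b ^ n = (\<Sum>w\<in>words_of_length X n. exp (b \<bullet> word_sum X w))"
proof (induction n)
  case 0
  have "words_of_length X 0 = {[]}"
    by (auto simp: words_of_length_def)
  then show ?case
    by simp
next
  case (Suc n)
  have "words_of_length X (Suc n) = (\<lambda>(w, i). i # w) ` (words_of_length X n \<times> {..<length X})"
    by (simp add: words_of_length_def lists_length_Suc_eq)
  then have "(\<Sum>w\<in>words_of_length X (Suc n). exp (b \<bullet> word_sum X w))
      = (\<Sum>(w, i)\<in>words_of_length X n \<times> {..<length X}. exp (b \<bullet> word_sum X w) * exp (b \<bullet> X ! i))"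
    by (simp add: sum.reindex inj_on_def case_prod_unfold inner_add_right exp_add mult.commute)
  also have "\<dots> = exp_sum X b ^ n * exp_sum X b"
    unfolding Suc by (simp add: exp_sum_eq_sum_nth sum_product sum.cartesian_product)
  finally show ?case
    by simp
qed

lemma card_word_sums_le: "card (word_sum X ` words_of_length X n) \<le> (n + 1) ^ length X"
proof -
  let ?combination = "\<lambda>a. \<Sum>j<length X. real (a j) *\<^sub>R X ! j"
  have "word_sum X w \<in> ?combination ` ({..<length X} \<rightarrow>\<^sub>E {..n})" if "w \<in> words_of_length X n" for w
  proof (rule image_eqI)
    show "word_sum X w = ?combination (restrict (count_list w) {..<length X})"
      using word_sum_eq_sum_count[of w X] that by (simp add: words_of_length_def)
    show "restrict (count_list w) {..<length X} \<in> {..<length X} \<rightarrow>\<^sub>E {..n}"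
      using count_le_length[of w] that by (auto simp: words_of_length_def)
  qed
  then have "word_sum X ` words_of_length X n \<subseteq> ?combination ` ({..<length X} \<rightarrow>\<^sub>E {..n})"
    by blast
  then have "card (word_sum X ` words_of_length X n) \<le> card ({..<length X} \<rightarrow>\<^sub>E {..n})"
    by (intro surj_card_le) (auto simp: finite_PiE)
  then show ?thesis
    by (simp add: card_PiE)
qed

definition words_of_sum :: "'a::real_vector list \<Rightarrow> 'a \<Rightarrow> nat list set" where
  "words_of_sum X z = {w. set w \<subseteq> {..<length X} \<and> word_sum X w = z}"

lemma word_mult_eq_card: "word_mult X z = card (words_of_sum X z)"
  by (simp add: word_mult_def words_of_sum_def word_sum_def)

subsection \<open>The cone and the semigroup of a family\<close>

lemma mem_rel_interior_convex_cone_iff: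
  fixes C :: "'a::euclidean_space set"
  assumes "convex_cone C"
  shows "x \<in> rel_interior C \<longleftrightarrow> (\<forall>v\<in>C. \<exists>e>0. x - e *\<^sub>R v \<in> C)"
proof -
  have "(\<exists>e>1. (1 - e) *\<^sub>R v + e *\<^sub>R x \<in> C) \<longleftrightarrow> (\<exists>e>0. x - e *\<^sub>R v \<in> C)" if "v \<in> C" for v
  proof safe
    fix e :: real assume "1 < e" "(1 - e) *\<^sub>R v + e *\<^sub>R x \<in> C"
    then have "(1 / e) *\<^sub>R ((1 - e) *\<^sub>R v + e *\<^sub>R x) \<in> C"
      using assms by (intro convex_cone_scaleR) auto
    also have "(1 / e) *\<^sub>R ((1 - e) *\<^sub>R v + e *\<^sub>R x) = x - ((e - 1) / e) *\<^sub>R v"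
      using \<open>1 < e\<close> by (simp add: algebra_simps diff_divide_distrib)
    finally show "\<exists>e>0. x - e *\<^sub>R v \<in> C"
      using \<open>1 < e\<close> by (intro exI[of _ "(e - 1) / e"]) simp
  next
    fix e :: real assume "0 < e" and diff: "x - e *\<^sub>R v \<in> C"
    have "x - e *\<^sub>R v + e *\<^sub>R v \<in> C"
      using assms diff \<open>0 < e\<close> that by (intro convex_cone_add convex_cone_scaleR) auto
    then have "x - e *\<^sub>R v + e *\<^sub>R x \<in> C"
      using assms diff \<open>0 < e\<close> by (intro convex_cone_add convex_cone_scaleR) auto
    then show "\<exists>e>1. (1 - e) *\<^sub>R v + e *\<^sub>R x \<in> C"
      using \<open>0 < e\<close> by (intro exI[of _ "1 + e"]) (simp add: algebra_simps)
  qed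
  moreover have "convex C"
    using assms by (simp add: convex_cone_def)
  ultimately show ?thesis
    using convex_rel_interior_iff[OF _ convex_cone_nonempty[OF assms], of x] by simp
qed

lemma rel_interior_convex_cone_scaleR:
  fixes C :: "'a::euclidean_space set"
  assumes "convex_cone C" and "x \<in> rel_interior C" and "0 < c"
  shows "c *\<^sub>R x \<in> rel_interior C"
proof -
  have "\<exists>e>0. c *\<^sub>R x - e *\<^sub>R v \<in> C" if "v \<in> C" for v
  proof -
    from assms(1,2) \<open>v \<in> C\<close> obtain e where "e > 0" "x - e *\<^sub>R v \<in> C"
      by (auto simp: mem_rel_interior_convex_cone_iff)
    then have "c *\<^sub>R (x - e *\<^sub>R v) \<in> C"
      using assms by (intro convex_cone_scaleR) auto
    then show ?thesis
      using \<open>e > 0\<close> \<open>0 < c\<close> by (intro exI[of _ "c * e"]) (simp add: scaleR_diff_right)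
  qed
  then show ?thesis
    using assms(1) by (simp add: mem_rel_interior_convex_cone_iff)
qed

lemma eventually_ray_minus_in_convex_cone:
  fixes C :: "'a::euclidean_space set"
  assumes "convex_cone C" and "x \<in> rel_interior C" and "v \<in> C"
  shows "\<forall>\<^sub>F t in at_top. t *\<^sub>R x - v \<in> C"
proof -
  obtain e where "0 < e" "x - e *\<^sub>R v \<in> C"
    using assms by (auto simp: mem_rel_interior_convex_cone_iff)
  have "t *\<^sub>R x - v \<in> C" if "1 / e \<le> t" for t
  proof -
    have "0 < 1 / e"
      using \<open>0 < e\<close> by simp
    then have "0 \<le> t"
      using that by linarith
    moreover have "0 \<le> t * e - 1"
      using that \<open>0 < e\<close> by (simp add: divide_le_eq)
    ultimately have "t *\<^sub>R (x - e *\<^sub>R v) + (t * e - 1) *\<^sub>R v \<in> C"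
      using assms(1,3) \<open>x - e *\<^sub>R v \<in> C\<close> by (intro convex_cone_add convex_cone_scaleR)
    then show ?thesis
      by (simp add: algebra_simps)
  qed
  then show ?thesis
    by (rule eventually_at_top_linorderI)
qed

lemma convex_cone_family_cone: "convex_cone (family_cone X)"
  unfolding convex_cone_iff
proof (intro conjI ballI allI impI)
  show "0 \<in> family_cone X"
    by (auto simp: family_cone_def intro!: exI[of _ "\<lambda>_. 0"])
next
  fix x y assume "x \<in> family_cone X" "y \<in> family_cone X"
  then obtain c d where "x = (\<Sum>j<length X. c j *\<^sub>R X ! j)" "y = (\<Sum>j<length X. d j *\<^sub>R X ! j)"
    "\<forall>j<length X. 0 \<le> c j" "\<forall>j<length X. 0 \<le> d j"
    by (auto simp: family_cone_def)
  then show "x + y \<in> family_cone X"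
    by (auto simp: family_cone_def sum.distrib scaleR_add_left intro!: exI[of _ "\<lambda>j. c j + d j"])
next
  fix x and t :: real assume "x \<in> family_cone X" "0 \<le> t"
  then obtain c where "x = (\<Sum>j<length X. c j *\<^sub>R X ! j)" "\<forall>j<length X. 0 \<le> c j"
    by (auto simp: family_cone_def)
  with \<open>0 \<le> t\<close> show "t *\<^sub>R x \<in> family_cone X"
    by (auto simp: family_cone_def scaleR_sum_right intro!: exI[of _ "\<lambda>j. t * c j"])
qed

lemma scaleR_rel_interior_in_family_cone:
  assumes "\<theta> \<in> rel_interior (family_cone X)" and "0 \<le> t"
  shows "t *\<^sub>R \<theta> \<in> family_cone X"
  using assms rel_interior_subset convex_cone_scaleR[OF convex_cone_family_cone] by blast

lemma sum_list_eq_sum_scaleR_one: "sum_list X = (\<Sum>j<length X. 1 *\<^sub>R X ! j)"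
  for X :: "'a::real_vector list"
  by (simp add: sum_list_sum_nth atLeast0LessThan)

lemma add_sum_list_in_rel_interior_family_cone:
  assumes "x \<in> family_cone X"
  shows "x + sum_list X \<in> rel_interior (family_cone X)"
  unfolding mem_rel_interior_convex_cone_iff[OF convex_cone_family_cone]
proof
  fix v assume "v \<in> family_cone X"
  with assms obtain c d where x: "x = (\<Sum>j<length X. c j *\<^sub>R X ! j)" "\<forall>j<length X. 0 \<le> c j"
    and v: "v = (\<Sum>j<length X. d j *\<^sub>R X ! j)" "\<forall>j<length X. 0 \<le> d j"
    by (auto simp: family_cone_def)
  define D where "D = 1 + (\<Sum>j<length X. d j)"
  have "1 \<le> D"
    using v(2) by (auto simp: D_def intro: sum_nonneg)
  have "0 \<le> c j + 1 - (1 / D) * d j" if "j < length X" for j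
  proof -
    have "d j \<le> D"
      unfolding D_def using member_le_sum[of j "{..<length X}" d] v(2) that by simp
    then show ?thesis
      using x(2) that \<open>1 \<le> D\<close> by (simp add: add_increasing)
  qed
  moreover have "x + sum_list X - (1 / D) *\<^sub>R v
      = (\<Sum>j<length X. (c j + 1 - (1 / D) * d j) *\<^sub>R X ! j)"
    unfolding x(1) v(1) sum_list_eq_sum_scaleR_one
    by (simp add: scaleR_add_left scaleR_diff_left sum.distrib sum_subtractf scaleR_sum_right)
  ultimately have "x + sum_list X - (1 / D) *\<^sub>R v \<in> family_cone X"
    by (auto simp: family_cone_def)
  then show "\<exists>e>0. x + sum_list X - e *\<^sub>R v \<in> family_cone X"
    using \<open>1 \<le> D\<close> by (intro exI[of _ "1 / D"]) simp
qed

lemma family_semigroup_eq_word_sums: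
  "family_semigroup X = word_sum X ` {w. set w \<subseteq> {..<length X}}"
proof (intro equalityI subsetI)
  fix z assume "z \<in> family_semigroup X"
  then obtain a :: "nat \<Rightarrow> nat" where z: "z = (\<Sum>j<length X. real (a j) *\<^sub>R X ! j)"
    by (auto simp: family_semigroup_def)
  define w where "w m = concat (map (\<lambda>j. replicate (a j) j) [0..<m])" for m
  have "word_sum X (replicate k j) = real k *\<^sub>R X ! j" for k j
    by (induction k) (simp_all add: scaleR_add_left)
  then have "word_sum X (w m) = (\<Sum>j<m. real (a j) *\<^sub>R X ! j)" for m
    by (induction m) (simp_all add: w_def)
  then show "z \<in> word_sum X ` {w. set w \<subseteq> {..<length X}}"
    using z by (intro image_eqI[of _ _ "w (length X)"]) (auto simp: w_def)
next
  fix z assume "z \<in> word_sum X ` {w. set w \<subseteq> {..<length X}}"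
  then show "z \<in> family_semigroup X"
    by (auto simp: family_semigroup_def dest: word_sum_eq_sum_count)
qed

lemma family_semigroup_0: "0 \<in> family_semigroup X"
  unfolding family_semigroup_eq_word_sums by (rule image_eqI[of _ _ "[]"]) auto

lemma family_semigroup_add:
  assumes "x \<in> family_semigroup X" and "y \<in> family_semigroup X"
  shows "x + y \<in> family_semigroup X"
proof -
  obtain v w where "set v \<subseteq> {..<length X}" "word_sum X v = x"
    and "set w \<subseteq> {..<length X}" "word_sum X w = y"
    using assms by (auto simp: family_semigroup_eq_word_sums)
  then show ?thesis
    unfolding family_semigroup_eq_word_sums by (intro image_eqI[of _ _ "v @ w"]) auto
qed

lemma family_semigroup_scaleR_of_nat:
  "x \<in> family_semigroup X \<Longrightarrow> real n *\<^sub>R x \<in> family_semigroup X"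
  by (induction n) (auto simp: family_semigroup_0 scaleR_add_left intro: family_semigroup_add)

lemma sum_list_in_family_semigroup: "sum_list X \<in> family_semigroup X"
  unfolding family_semigroup_def sum_list_eq_sum_scaleR_one by (auto intro!: exI[of _ "\<lambda>_. 1"])

lemma family_semigroup_subset_cone: "family_semigroup X \<subseteq> family_cone X"
  unfolding family_semigroup_def family_cone_def by fastforce

lemma eventually_multiple_minus_in_family_semigroup:
  assumes "z \<in> family_semigroup X"
  shows "\<forall>\<^sub>F n in sequentially. real n *\<^sub>R sum_list X - z \<in> family_semigroup X"
proof -
  obtain a :: "nat \<Rightarrow> nat" where z: "z = (\<Sum>j<length X. real (a j) *\<^sub>R X ! j)"
    using assms by (auto simp: family_semigroup_def)
  have "real n *\<^sub>R sum_list X - z \<in> family_semigroup X" if "(\<Sum>j<length X. a j) \<le> n" for n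
  proof -
    have "a j \<le> n" if "j < length X" for j
      using member_le_sum[of j "{..<length X}" a] \<open>(\<Sum>j<length X. a j) \<le> n\<close> that by simp
    then have "real n *\<^sub>R sum_list X - z = (\<Sum>j<length X. real (n - a j) *\<^sub>R X ! j)"
      by (simp add: z sum_list_eq_sum_scaleR_one scaleR_sum_right scaleR_diff_left of_nat_diff
          flip: sum_subtractf)
    then show ?thesis
      by (auto simp: family_semigroup_def intro!: exI[of _ "\<lambda>j. n - a j"])
  qed
  then show ?thesis
    by (rule eventually_sequentiallyI)
qed

definition family_group :: "(real ^ 'n) list \<Rightarrow> (real ^ 'n) set" where
  "family_group X = {y - z | y z. y \<in> family_semigroup X \<and> z \<in> family_semigroup X}"

lemma family_group_diff_semigroup:
  assumes "v \<in> family_group X" and "w \<in> family_semigroup X"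
  shows "v - w \<in> family_group X"
proof -
  obtain y z where "v = y - z" "y \<in> family_semigroup X" "z \<in> family_semigroup X"
    using assms(1) by (auto simp: family_group_def)
  moreover from this have "v - w = y - (z + w)"
    by simp
  ultimately show ?thesis
    unfolding family_group_def using family_semigroup_add assms(2) by blast
qed

lemma finite_translate_into_family_semigroup:
  assumes "finite V" and "V \<subseteq> family_group X"
  obtains n :: nat where "\<And>v. v \<in> V \<Longrightarrow> v + real n *\<^sub>R sum_list X \<in> family_semigroup X"
proof -
  have "\<forall>\<^sub>F n in sequentially. v + real n *\<^sub>R sum_list X \<in> family_semigroup X" if "v \<in> V" for v
  proof -
    obtain y z where "v = y - z" "y \<in> family_semigroup X" "z \<in> family_semigroup X"
      using assms(2) \<open>v \<in> V\<close> by (auto simp: family_group_def)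
    from eventually_multiple_minus_in_family_semigroup[OF this(3)] show ?thesis
    proof eventually_elim
      case (elim n)
      then have "y + (real n *\<^sub>R sum_list X - z) \<in> family_semigroup X"
        using \<open>y \<in> family_semigroup X\<close> by (intro family_semigroup_add)
      then show ?case
        by (simp add: \<open>v = y - z\<close> algebra_simps)
    qed
  qed
  then have "\<forall>\<^sub>F n in sequentially. \<forall>v\<in>V. v + real n *\<^sub>R sum_list X \<in> family_semigroup X"
    using assms(1) by (simp add: eventually_ball_finite)
  then show thesis
    using eventually_happens' sequentially_bot that by blast
qed

definition total_norm :: "'a::real_normed_vector list \<Rightarrow> real" where
  "total_norm X = (\<Sum>x\<leftarrow>X. norm x)"

lemma family_cone_obtain_near_family_semigroup:
  assumes "x \<in> family_cone X"
  obtains z where "z \<in> family_semigroup X" "norm (x - z) \<le> total_norm X"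
proof -
  from assms obtain c where x: "x = (\<Sum>j<length X. c j *\<^sub>R X ! j)"
    and c: "\<And>j. j < length X \<Longrightarrow> 0 \<le> c j"
    by (auto simp: family_cone_def)
  let ?z = "\<Sum>j<length X. real (nat \<lfloor>c j\<rfloor>) *\<^sub>R X ! j"
  have "norm (x - ?z) = norm (\<Sum>j<length X. frac (c j) *\<^sub>R X ! j)"
    by (simp add: x c frac_def scaleR_diff_left sum_subtractf)
  also have "\<dots> \<le> (\<Sum>j<length X. norm (X ! j))"
    by (intro sum_norm_le) (simp add: mult_left_le_one_le frac_lt_1 less_imp_le)
  finally have "norm (x - ?z) \<le> total_norm X"
    by (simp add: total_norm_def sum_list_sum_nth atLeast0LessThan)
  moreover have "?z \<in> family_semigroup X"
    by (auto simp: family_semigroup_def)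
  ultimately show thesis
    using that by blast
qed

subsection \<open>Families in a half-space\<close>

lemma uniform_discrete_Ints_cart: "uniform_discrete {x :: real ^ 'n. \<forall>i. x $ i \<in> \<int>}"
  unfolding uniform_discrete_def
proof (intro exI[of _ 1] conjI ballI impI)
  fix x y :: "real ^ 'n"
  assume integral: "x \<in> {x. \<forall>i. x $ i \<in> \<int>}" "y \<in> {x. \<forall>i. x $ i \<in> \<int>}" and "dist x y < 1"
  have "x $ i - y $ i = 0" for i
  proof (rule ccontr)
    have "\<bar>x $ i - y $ i\<bar> < 1"
      using component_le_norm_cart[of "x - y" i] \<open>dist x y < 1\<close> by (simp add: dist_norm)
    moreover assume "x $ i - y $ i \<noteq> 0"
    ultimately show False
      using integral Ints_nonzero_abs_less1[of "x $ i - y $ i"] by auto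
  qed
  then show "x = y"
    by (simp add: vec_eq_iff)
qed simp

abbreviation log_cone_mult :: "(real ^ 'n) list \<Rightarrow> real ^ 'n \<Rightarrow> real" where
  "log_cone_mult X x \<equiv> ln (real (cone_mult X x))"

locale half_space_family =
  fixes X :: "(real ^ 'n) list"
  assumes integral: "x \<in> set X \<Longrightarrow> x $ i \<in> \<int>"
    and half_space: "\<exists>\<alpha>. \<forall>x\<in>set X. 0 < x \<bullet> \<alpha>"
begin

lemma half_space_ge_1: "\<exists>\<alpha>. \<forall>x\<in>set X. 1 \<le> \<alpha> \<bullet> x"
proof -
  obtain \<beta> where \<beta>: "\<And>x. x \<in> set X \<Longrightarrow> 0 < \<beta> \<bullet> x"
    using half_space by (auto simp: inner_commute)
  define \<alpha> where "\<alpha> = (\<Sum>y\<in>set X. 1 / (\<beta> \<bullet> y)) *\<^sub>R \<beta>"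
  have "1 \<le> \<alpha> \<bullet> x" if "x \<in> set X" for x
  proof -
    have "1 / (\<beta> \<bullet> x) \<le> (\<Sum>y\<in>set X. 1 / (\<beta> \<bullet> y))"
      using that \<beta> by (intro member_le_sum) (auto intro: less_imp_le)
    then show ?thesis
      using \<beta>[OF that] by (simp add: \<alpha>_def pos_divide_le_eq)
  qed
  then show ?thesis
    by blast
qed

lemma exists_exp_sum_le_1: "\<exists>b. exp_sum X b \<le> 1"
proof -
  obtain \<alpha> where \<alpha>: "\<And>x. x \<in> set X \<Longrightarrow> 1 \<le> \<alpha> \<bullet> x"
    using half_space_ge_1 by blast
  let ?c = "ln (real (length X))"
  have "exp ((- ?c *\<^sub>R \<alpha>) \<bullet> x) \<le> exp (- ?c)" if "x \<in> set X" for x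
  proof -
    have "0 \<le> ?c"
      using that by (cases X) auto
    then show ?thesis
      using mult_left_mono[OF \<alpha>[OF that], of ?c] by simp
  qed
  then have "exp_sum X (- ?c *\<^sub>R \<alpha>) \<le> (\<Sum>x\<leftarrow>X. exp (- ?c))"
    unfolding exp_sum_def by (rule sum_list_mono)
  also have "\<dots> \<le> 1"
    by (cases "X = []") (simp_all add: sum_list_triv exp_minus)
  finally show ?thesis
    by blast
qed

lemma length_le_inner_word_sum:
  "\<exists>\<alpha>. \<forall>w. set w \<subseteq> {..<length X} \<longrightarrow> real (length w) \<le> \<alpha> \<bullet> word_sum X w"
proof -
  obtain \<alpha> where \<alpha>: "\<And>x. x \<in> set X \<Longrightarrow> 1 \<le> \<alpha> \<bullet> x"
    using half_space_ge_1 by blast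
  have "real (length w) \<le> \<alpha> \<bullet> word_sum X w" if "set w \<subseteq> {..<length X}" for w
    using that
  proof (induction w)
    case (Cons i w)
    then show ?case
      using \<alpha>[of "X ! i"] by (simp add: inner_add_right)
  qed simp
  then show ?thesis
    by blast
qed

lemma words_of_sum_0: "words_of_sum X 0 = {[]}"
proof -
  obtain \<alpha> where "\<And>w. set w \<subseteq> {..<length X} \<Longrightarrow> real (length w) \<le> \<alpha> \<bullet> word_sum X w"
    using length_le_inner_word_sum by blast
  from this have "w = []" if "w \<in> words_of_sum X 0" for w
    using that by (fastforce simp: words_of_sum_def)
  then show ?thesis
    by (auto simp: words_of_sum_def)
qed

lemma words_of_sum_length_bounded: "\<exists>n. \<forall>w\<in>words_of_sum X z. length w \<le> n"
proof -
  obtain \<alpha> where "\<And>w. set w \<subseteq> {..<length X} \<Longrightarrow> real (length w) \<le> \<alpha> \<bullet> word_sum X w"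
    using length_le_inner_word_sum by blast
  then have "length w \<le> nat \<lfloor>\<alpha> \<bullet> z\<rfloor>" if "w \<in> words_of_sum X z" for w
    using that by (auto simp: words_of_sum_def le_nat_floor)
  then show ?thesis
    by blast
qed

lemma finite_words_of_sum: "finite (words_of_sum X z)"
proof -
  obtain n where "\<forall>w\<in>words_of_sum X z. length w \<le> n"
    using words_of_sum_length_bounded by blast
  then have "words_of_sum X z \<subseteq> {w. set w \<subseteq> {..<length X} \<and> length w \<le> n}"
    by (auto simp: words_of_sum_def)
  then show ?thesis
    by (rule finite_subset) (simp add: finite_lists_length_le)
qed

lemma word_mult_pos:
  assumes "z \<in> family_semigroup X"
  shows "0 < word_mult X z"
proof -
  have "words_of_sum X z \<noteq> {}"
    using assms by (auto simp: family_semigroup_eq_word_sums words_of_sum_def)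
  then show ?thesis
    by (simp add: word_mult_eq_card card_gt_0_iff finite_words_of_sum)
qed

lemma word_mult_supermultiplicative: "word_mult X y * word_mult X z \<le> word_mult X (y + z)"
proof -
  have "inj_on (\<lambda>(v, w). v @ w) (words_of_sum X y \<times> words_of_sum X z)"
  proof (rule inj_onI, clarify)
    fix v w v' w'
    assume words: "v \<in> words_of_sum X y" "v' \<in> words_of_sum X y" and "v @ w = v' @ w'"
    then consider (longer) u where "v = v' @ u" "u @ w = w'"
      | (shorter) u where "v @ u = v'" "w = u @ w'"
      unfolding append_eq_append_conv2 by blast
    then show "v = v' \<and> w = w'"
    proof cases
      case (longer u)
      then have "u \<in> words_of_sum X 0"
        using words by (simp add: words_of_sum_def)
      with longer show ?thesis
        by (simp add: words_of_sum_0)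
    next
      case (shorter u)
      then have "u \<in> words_of_sum X 0"
        using words by (auto simp: words_of_sum_def)
      with shorter show ?thesis
        by (simp add: words_of_sum_0)
    qed
  qed
  then have "card (words_of_sum X y \<times> words_of_sum X z)
      = card ((\<lambda>(v, w). v @ w) ` (words_of_sum X y \<times> words_of_sum X z))"
    by (simp add: card_image)
  also have "\<dots> \<le> card (words_of_sum X (y + z))"
    by (intro card_mono finite_words_of_sum) (auto simp: words_of_sum_def)
  finally show ?thesis
    by (simp add: word_mult_eq_card card_cartesian_product)
qed

lemma word_mult_le_add:
  assumes "z \<in> family_semigroup X"
  shows "word_mult X y \<le> word_mult X (y + z)"
proof -
  have "word_mult X y \<le> word_mult X y * word_mult X z"
    using word_mult_pos[OF assms] by simp
  also have "\<dots> \<le> word_mult X (y + z)"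
    by (rule word_mult_supermultiplicative)
  finally show ?thesis .
qed

lemma word_mult_power_le: "word_mult X z ^ n \<le> word_mult X (real n *\<^sub>R z)"
proof (induction n)
  case 0
  show ?case
    using word_mult_pos[OF family_semigroup_0] by simp
next
  case (Suc n)
  have "word_mult X z ^ Suc n \<le> word_mult X z * word_mult X (real n *\<^sub>R z)"
    using Suc by simp
  also have "\<dots> \<le> word_mult X (z + real n *\<^sub>R z)"
    by (rule word_mult_supermultiplicative)
  finally show ?case
    by (simp add: scaleR_add_left add.commute)
qed

lemma card_short_words_of_sum_Suc_le:
  assumes "z \<noteq> 0"
  shows "card {w \<in> words_of_sum X z. length w \<le> Suc n}
    \<le> (\<Sum>i<length X. card {w \<in> words_of_sum X (z - X ! i). length w \<le> n})"
proof -
  let ?W = "\<lambda>z n. {w \<in> words_of_sum X z. length w \<le> n}"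
  have "?W z (Suc n) \<subseteq> (\<Union>i<length X. (#) i ` ?W (z - X ! i) n)"
  proof
    fix w assume "w \<in> ?W z (Suc n)"
    with assms obtain i v where "w = i # v" "i < length X" "v \<in> ?W (z - X ! i) n"
      by (cases w) (auto simp: words_of_sum_def)
    then show "w \<in> (\<Union>i<length X. (#) i ` ?W (z - X ! i) n)"
      by blast
  qed
  then have "card (?W z (Suc n)) \<le> card (\<Union>i<length X. (#) i ` ?W (z - X ! i) n)"
    using finite_words_of_sum by (intro card_mono) auto
  also have "\<dots> \<le> (\<Sum>i<length X. card ((#) i ` ?W (z - X ! i) n))"
    by (rule card_UN_le) simp
  also have "\<dots> = (\<Sum>i<length X. card (?W (z - X ! i) n))"
    by (simp add: card_image)
  finally show ?thesis .
qed

text \<open>Kraft's inequality for the words with sum \<open>z\<close>, the letter \<open>i\<close> having weight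
  \<open>exp (b \<bullet> X ! i)\<close>.\<close>

lemma card_short_words_mult_exp_le_1:
  assumes "exp_sum X b \<le> 1"
  shows "real (card {w \<in> words_of_sum X z. length w \<le> n}) * exp (b \<bullet> z) \<le> 1"
proof (induction n arbitrary: z)
  case 0
  have "{w \<in> words_of_sum X z. length w \<le> 0} = (if z = 0 then {[]} else {})"
    by (auto simp: words_of_sum_def)
  then show ?case
    by simp
next
  case (Suc n)
  let ?N = "\<lambda>z n. real (card {w \<in> words_of_sum X z. length w \<le> n})"
  show ?case
  proof (cases "z = 0")
    case True
    have "{w \<in> words_of_sum X z. length w \<le> Suc n} = {[]}"
      by (auto simp: True words_of_sum_0)
    then show ?thesis
      by (simp add: True)
  next
    case False
    have "?N z (Suc n) * exp (b \<bullet> z) \<le> (\<Sum>i<length X. ?N (z - X ! i) n) * exp (b \<bullet> z)"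
      using card_short_words_of_sum_Suc_le[OF False, of n]
      by (intro mult_right_mono) (simp_all flip: of_nat_sum)
    also have "\<dots> = (\<Sum>i<length X. ?N (z - X ! i) n * exp (b \<bullet> (z - X ! i)) * exp (b \<bullet> X ! i))"
      by (simp add: sum_distrib_right mult.assoc inner_diff_right flip: exp_add)
    also have "\<dots> \<le> (\<Sum>i<length X. 1 * exp (b \<bullet> X ! i))"
      by (intro sum_mono mult_right_mono Suc) simp
    also have "\<dots> \<le> 1"
      using assms by (simp add: exp_sum_eq_sum_nth)
    finally show ?thesis .
  qed
qed

lemma word_mult_exp_le_1:
  assumes "exp_sum X b \<le> 1"
  shows "real (word_mult X z) * exp (b \<bullet> z) \<le> 1"
proof -
  obtain n where "\<forall>w\<in>words_of_sum X z. length w \<le> n"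
    using words_of_sum_length_bounded by blast
  then have "{w \<in> words_of_sum X z. length w \<le> n} = words_of_sum X z"
    by auto
  then show ?thesis
    using card_short_words_mult_exp_le_1[OF assms, of z n] by (simp add: word_mult_eq_card)
qed

lemma exp_sum_power_le_if_word_mult_exp_bounded:
  assumes bounded: "\<And>z. z \<in> family_semigroup X \<Longrightarrow> real (word_mult X z) * exp (b \<bullet> z) \<le> C"
  shows "exp_sum X b ^ n \<le> real (n + 1) ^ length X * C"
proof -
  let ?W = "words_of_length X n"
  have "exp_sum X b ^ n
      = (\<Sum>z\<in>word_sum X ` ?W. \<Sum>w | w \<in> ?W \<and> word_sum X w = z. exp (b \<bullet> word_sum X w))"
    unfolding exp_sum_power_eq_sum_words
    by (rule sum.group[symmetric]) (auto simp: words_of_length_def finite_lists_length_eq)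
  also have "\<dots> \<le> (\<Sum>z\<in>word_sum X ` ?W. C)"
  proof (rule sum_mono)
    fix z assume "z \<in> word_sum X ` ?W"
    have "(\<Sum>w | w \<in> ?W \<and> word_sum X w = z. exp (b \<bullet> word_sum X w))
        = real (card {w \<in> ?W. word_sum X w = z}) * exp (b \<bullet> z)"
      by simp
    also have "\<dots> \<le> real (word_mult X z) * exp (b \<bullet> z)"
      unfolding word_mult_eq_card
      by (intro mult_right_mono of_nat_mono card_mono finite_words_of_sum)
        (auto simp: words_of_length_def words_of_sum_def)
    also have "\<dots> \<le> C"
      using \<open>z \<in> word_sum X ` ?W\<close>
      by (intro bounded) (auto simp: words_of_length_def family_semigroup_eq_word_sums)
    finally show "(\<Sum>w | w \<in> ?W \<and> word_sum X w = z. exp (b \<bullet> word_sum X w)) \<le> C" .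
  qed
  also have "\<dots> = real (card (word_sum X ` ?W)) * C"
    by simp
  also have "\<dots> \<le> real ((n + 1) ^ length X) * C"
  proof (intro mult_right_mono of_nat_mono card_word_sums_le)
    show "0 \<le> C"
      using bounded[OF family_semigroup_0] by (rule order_trans[rotated]) simp
  qed
  finally show ?thesis
    by simp
qed

lemma exp_sum_le_1_if_word_mult_exp_bounded:
  assumes bounded: "\<And>z. z \<in> family_semigroup X \<Longrightarrow> real (word_mult X z) * exp (b \<bullet> z) \<le> C"
  shows "exp_sum X b \<le> 1"
proof (rule ccontr)
  have bound: "exp_sum X b ^ n / real (n + 1) ^ length X \<le> C" for n
    using exp_sum_power_le_if_word_mult_exp_bounded[OF bounded, of n]
    by (simp add: divide_le_eq mult.commute)
  assume "\<not> exp_sum X b \<le> 1"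
  then have "1 < exp_sum X b"
    by simp
  then have "filterlim (\<lambda>n. exp_sum X b ^ n / real (n + 1) ^ length X) at_top sequentially"
    by real_asymp
  then have "\<forall>\<^sub>F n in sequentially. C < exp_sum X b ^ n / real (n + 1) ^ length X"
    by (simp add: filterlim_at_top_dense)
  then obtain n where "C < exp_sum X b ^ n / real (n + 1) ^ length X"
    using eventually_happens' sequentially_bot by blast
  with bound[of n] show False
    by simp
qed

lemma family_semigroup_integral:
  assumes "z \<in> family_semigroup X"
  shows "z $ i \<in> \<int>"
  using assms
  by (auto simp: family_semigroup_def sum_component intro!: Ints_sum Ints_mult integral[OF nth_mem])

lemma closed_family_semigroup: "closed (family_semigroup X)"
  by (intro uniform_discrete_imp_closed uniform_discrete_subset[OF uniform_discrete_Ints_cart])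
    (auto intro: family_semigroup_integral)

lemma finite_bounded_family_group: "finite {v \<in> family_group X. norm v \<le> R}" (is "finite ?V")
proof -
  have "uniform_discrete ?V"
    by (rule uniform_discrete_subset[OF uniform_discrete_Ints_cart])
      (auto simp: family_group_def family_semigroup_integral)
  moreover have "bounded ?V"
    by (auto simp: bounded_iff)
  ultimately show ?thesis
    using uniform_discrete_finite_iff by blast
qed

text \<open>Far out on the ray, \<open>t \<theta>\<close> minus a given multiple of \<open>sum_list X\<close> is still in the cone, hence
  close to the semigroup. The multiple pushes each of the finitely many possible remainders into
  the semigroup.\<close>

lemma eventually_near_ray_in_family_semigroup:
  assumes "\<theta> \<in> rel_interior (family_cone X)"
  shows "\<forall>\<^sub>F t in at_top. \<forall>v\<in>family_group X. norm (v - t *\<^sub>R \<theta>) \<le> R \<longrightarrow> v \<in> family_semigroup X"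
proof -
  let ?J = "family_semigroup X"
  have "finite {u \<in> family_group X. norm u \<le> R + total_norm X}"
    by (rule finite_bounded_family_group)
  then obtain n :: nat where n: "\<And>u. u \<in> family_group X \<Longrightarrow> norm u \<le> R + total_norm X
      \<Longrightarrow> u + real n *\<^sub>R sum_list X \<in> ?J"
    by (rule finite_translate_into_family_semigroup[where X = X]) auto
  define s where "s = real n *\<^sub>R sum_list X"
  have "s \<in> ?J"
    unfolding s_def by (intro family_semigroup_scaleR_of_nat sum_list_in_family_semigroup)
  then have "\<forall>\<^sub>F t in at_top. t *\<^sub>R \<theta> - s \<in> family_cone X"
    using assms family_semigroup_subset_cone
    by (intro eventually_ray_minus_in_convex_cone convex_cone_family_cone) auto
  then show ?thesis
  proof eventually_elim
    case (elim t)
    then obtain w where w: "w \<in> ?J" "norm (t *\<^sub>R \<theta> - s - w) \<le> total_norm X"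
      by (rule family_cone_obtain_near_family_semigroup)
    show ?case
    proof (intro ballI impI)
      fix v assume v: "v \<in> family_group X" and near: "norm (v - t *\<^sub>R \<theta>) \<le> R"
      have "norm (v - s - w) \<le> R + total_norm X"
        using norm_triangle_mono[OF near w(2)] by (simp add: algebra_simps)
      moreover have "v - s - w \<in> family_group X"
        using v \<open>s \<in> ?J\<close> w(1) by (intro family_group_diff_semigroup)
      ultimately have "w + (v - s - w + s) \<in> ?J"
        unfolding s_def by (intro family_semigroup_add w(1) n)
      then show "v \<in> ?J"
        by simp
    qed
  qed
qed

lemma cone_mult_eq_word_mult:
  assumes "z \<in> family_semigroup X"
  shows "cone_mult X z = word_mult X z"
proof -
  have "{word_mult X y | y. y \<in> family_semigroup X \<and> norm (z - y) = infdist z (family_semigroup X)}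
      = {word_mult X z}"
    using assms by auto
  then show ?thesis
    by (simp add: cone_mult_def)
qed

lemma cone_mult_obtain_near_family_semigroup:
  assumes "x \<in> family_cone X"
  obtains z where "z \<in> family_semigroup X" "norm (x - z) \<le> total_norm X"
    "cone_mult X x = word_mult X z"
proof -
  let ?J = "family_semigroup X"
  let ?M = "{word_mult X z | z. z \<in> ?J \<and> norm (x - z) = infdist x ?J}"
  have "?J \<noteq> {}"
    using family_semigroup_0 by blast
  then obtain y where "y \<in> ?J" "infdist x ?J = dist x y"
    using infdist_attains_inf[OF closed_family_semigroup] by blast
  then have "word_mult X y \<in> ?M"
    by (auto simp: dist_norm)
  then have "Inf ?M \<in> ?M"
    by (intro Inf_nat_def1) blast
  then obtain z where z: "z \<in> ?J" "norm (x - z) = infdist x ?J" "cone_mult X x = word_mult X z"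
    by (auto simp: cone_mult_def)
  obtain z' where "z' \<in> ?J" "norm (x - z') \<le> total_norm X"
    using assms by (rule family_cone_obtain_near_family_semigroup)
  then have "infdist x ?J \<le> total_norm X"
    by (intro infdist_le2[of z']) (auto simp: dist_norm)
  with z show thesis
    by (intro that) auto
qed

lemma cone_mult_pos:
  assumes "x \<in> family_cone X"
  shows "0 < cone_mult X x"
  using assms by (rule cone_mult_obtain_near_family_semigroup) (simp add: word_mult_pos)

lemma ln_word_mult_le:
  assumes "exp_sum X b \<le> 1" and "z \<in> family_semigroup X"
  shows "ln (real (word_mult X z)) \<le> - (b \<bullet> z)"
proof -
  have "ln (real (word_mult X z) * exp (b \<bullet> z)) \<le> ln 1"
    using word_mult_exp_le_1[OF assms(1), of z] word_mult_pos[OF assms(2)] by (intro ln_mono) auto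
  then show ?thesis
    using word_mult_pos[OF assms(2)] by (simp add: ln_mult)
qed

lemma log_cone_mult_le:
  assumes "exp_sum X b \<le> 1" and "x \<in> family_cone X"
  shows "log_cone_mult X x \<le> norm b * total_norm X - b \<bullet> x"
proof -
  obtain z where z: "z \<in> family_semigroup X" "norm (x - z) \<le> total_norm X"
    "cone_mult X x = word_mult X z"
    using assms(2) by (rule cone_mult_obtain_near_family_semigroup)
  have "log_cone_mult X x \<le> b \<bullet> (x - z) - b \<bullet> x"
    using ln_word_mult_le[OF assms(1) z(1)] by (simp add: z(3) inner_diff_right)
  also have "b \<bullet> (x - z) \<le> norm b * norm (x - z)"
    by (rule norm_cauchy_schwarz)
  also have "\<dots> \<le> norm b * total_norm X"
    using z(2) by (rule mult_left_mono) simp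
  finally show ?thesis
    by simp
qed

lemma cone_mult_mult_le:
  assumes "x \<in> family_cone X" and "y \<in> family_cone X" and "z \<in> family_cone X"
    and near: "\<And>v. v \<in> family_group X \<Longrightarrow> norm (v - (z - (x + y))) \<le> 3 * total_norm X
      \<Longrightarrow> v \<in> family_semigroup X"
  shows "cone_mult X x * cone_mult X y \<le> cone_mult X z"
proof -
  obtain x' where x': "x' \<in> family_semigroup X" "norm (x - x') \<le> total_norm X"
    "cone_mult X x = word_mult X x'"
    using assms(1) by (rule cone_mult_obtain_near_family_semigroup)
  obtain y' where y': "y' \<in> family_semigroup X" "norm (y - y') \<le> total_norm X"
    "cone_mult X y = word_mult X y'"
    using assms(2) by (rule cone_mult_obtain_near_family_semigroup)
  obtain z' where z': "z' \<in> family_semigroup X" "norm (z - z') \<le> total_norm X"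
    "cone_mult X z = word_mult X z'"
    using assms(3) by (rule cone_mult_obtain_near_family_semigroup)
  have "z' - (x' + y') - (z - (x + y)) = ((x - x') + (y - y')) - (z - z')"
    by simp
  also have "norm \<dots> \<le> norm (x - x') + norm (y - y') + norm (z - z')"
    by (intro order_trans[OF norm_triangle_ineq4] add_right_mono norm_triangle_ineq)
  also have "\<dots> \<le> 3 * total_norm X"
    using x'(2) y'(2) z'(2) by simp
  finally have "norm (z' - (x' + y') - (z - (x + y))) \<le> 3 * total_norm X" .
  moreover have "z' - (x' + y') \<in> family_group X"
    unfolding family_group_def using z'(1) family_semigroup_add[OF x'(1) y'(1)] by blast
  ultimately have diff: "z' - (x' + y') \<in> family_semigroup X"
    by (intro near)
  have "word_mult X x' * word_mult X y' \<le> word_mult X (x' + y')"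
    by (rule word_mult_supermultiplicative)
  also have "\<dots> \<le> word_mult X z'"
    using word_mult_le_add[OF diff, of "x' + y'"] by simp
  finally show ?thesis
    by (simp add: x'(3) y'(3) z'(3))
qed

lemma cone_mult_supermultiplicative_on_ray:
  assumes "\<theta> \<in> rel_interior (family_cone X)"
  obtains r where "0 < r"
    "\<And>s t. 0 \<le> s \<Longrightarrow> 0 \<le> t
      \<Longrightarrow> cone_mult X (s *\<^sub>R \<theta>) * cone_mult X (t *\<^sub>R \<theta>) \<le> cone_mult X ((s + t + r) *\<^sub>R \<theta>)"
proof -
  have "\<forall>\<^sub>F r in at_top. 0 < r \<and>
      (\<forall>v\<in>family_group X. norm (v - r *\<^sub>R \<theta>) \<le> 3 * total_norm X \<longrightarrow> v \<in> family_semigroup X)"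
    by (intro eventually_conj eventually_gt_at_top eventually_near_ray_in_family_semigroup assms)
  then obtain r where "0 < r" and near_ray: "\<And>v. v \<in> family_group X
      \<Longrightarrow> norm (v - r *\<^sub>R \<theta>) \<le> 3 * total_norm X \<Longrightarrow> v \<in> family_semigroup X"
    using eventually_happens'[OF trivial_limit_at_top_linorder] by blast
  have "cone_mult X (s *\<^sub>R \<theta>) * cone_mult X (t *\<^sub>R \<theta>) \<le> cone_mult X ((s + t + r) *\<^sub>R \<theta>)"
    if "0 \<le> s" "0 \<le> t" for s t
  proof (rule cone_mult_mult_le)
    fix v assume "v \<in> family_group X"
      and "norm (v - ((s + t + r) *\<^sub>R \<theta> - (s *\<^sub>R \<theta> + t *\<^sub>R \<theta>))) \<le> 3 * total_norm X"
    moreover have "(s + t + r) *\<^sub>R \<theta> - (s *\<^sub>R \<theta> + t *\<^sub>R \<theta>) = r *\<^sub>R \<theta>"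
      by (simp add: scaleR_add_left)
    ultimately show "v \<in> family_semigroup X"
      by (intro near_ray) simp_all
  qed (use that \<open>0 < r\<close> in \<open>auto intro: scaleR_rel_interior_in_family_cone[OF assms]\<close>)
  with \<open>0 < r\<close> show thesis
    by (rule that)
qed

lemma log_cone_mult_quotient_convergent:
  assumes "\<theta> \<in> rel_interior (family_cone X)"
  obtains L where "((\<lambda>t. log_cone_mult X (t *\<^sub>R \<theta>) / t) \<longlongrightarrow> L) at_top"
proof -
  obtain r where "0 < r" and super: "\<And>s t. 0 \<le> s \<Longrightarrow> 0 \<le> t
      \<Longrightarrow> cone_mult X (s *\<^sub>R \<theta>) * cone_mult X (t *\<^sub>R \<theta>) \<le> cone_mult X ((s + t + r) *\<^sub>R \<theta>)"
    using cone_mult_supermultiplicative_on_ray[OF assms] by blast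
  obtain b where b: "exp_sum X b \<le> 1"
    using exists_exp_sum_le_1 by blast
  have ray: "t *\<^sub>R \<theta> \<in> family_cone X" if "0 \<le> t" for t
    using assms that by (rule scaleR_rel_interior_in_family_cone)
  then have pos: "0 < cone_mult X (t *\<^sub>R \<theta>)" if "0 \<le> t" for t
    using that by (intro cone_mult_pos)
  show thesis
  proof (rule shifted_superadditive_quotient_convergent[OF \<open>0 < r\<close> _ _ _ that])
    fix s t :: real assume nonneg: "0 \<le> s" "0 \<le> t"
    then have "ln (real (cone_mult X (s *\<^sub>R \<theta>)) * real (cone_mult X (t *\<^sub>R \<theta>)))
        \<le> log_cone_mult X ((s + t + r) *\<^sub>R \<theta>)"
      using super pos by (intro ln_mono) (simp_all flip: of_nat_mult)
    then show "log_cone_mult X (s *\<^sub>R \<theta>) + log_cone_mult X (t *\<^sub>R \<theta>)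
        \<le> log_cone_mult X ((s + t + r) *\<^sub>R \<theta>)"
      using nonneg pos by (simp add: ln_mult)
  next
    fix t :: real assume "0 \<le> t"
    then show "0 \<le> log_cone_mult X (t *\<^sub>R \<theta>)"
      using pos[of t] by simp
    show "log_cone_mult X (t *\<^sub>R \<theta>) \<le> norm b * total_norm X + - (b \<bullet> \<theta>) * t"
      using log_cone_mult_le[OF b ray[OF \<open>0 \<le> t\<close>]] by (simp add: mult.commute)
  qed
qed

lemma dir_growth_tendsto:
  assumes "\<theta> \<in> rel_interior (family_cone X)"
  shows "((\<lambda>t. log_cone_mult X (t *\<^sub>R \<theta>) / t) \<longlongrightarrow> dir_growth X \<theta>) at_top"
proof -
  obtain L where L: "((\<lambda>t. log_cone_mult X (t *\<^sub>R \<theta>) / t) \<longlongrightarrow> L) at_top"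
    using assms by (rule log_cone_mult_quotient_convergent)
  have "(\<lambda>k. log_cone_mult X (real k *\<^sub>R \<theta>) / real k) \<longlonglongrightarrow> L"
    using L filterlim_real_sequentially by (rule filterlim_compose)
  then have "dir_growth X \<theta> = L"
    by (simp add: dir_growth_def limI)
  with L show ?thesis
    by simp
qed

lemma dir_growth_scaleR:
  assumes "\<theta> \<in> rel_interior (family_cone X)" and "0 < c"
  shows "dir_growth X (c *\<^sub>R \<theta>) = c * dir_growth X \<theta>"
proof (rule tendsto_unique)
  have "filterlim (\<lambda>t. t * c) at_top at_top"
    using \<open>0 < c\<close> by real_asymp
  then have "((\<lambda>t. log_cone_mult X ((t * c) *\<^sub>R \<theta>) / (t * c)) \<longlongrightarrow> dir_growth X \<theta>) at_top"
    using dir_growth_tendsto[OF assms(1)] by (rule filterlim_compose[rotated])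
  then have "((\<lambda>t. c * (log_cone_mult X ((t * c) *\<^sub>R \<theta>) / (t * c)))
      \<longlongrightarrow> c * dir_growth X \<theta>) at_top"
    by (rule tendsto_mult_left)
  then show "((\<lambda>t. log_cone_mult X (t *\<^sub>R (c *\<^sub>R \<theta>)) / t) \<longlongrightarrow> c * dir_growth X \<theta>) at_top"
    using \<open>0 < c\<close> by simp
  show "((\<lambda>t. log_cone_mult X (t *\<^sub>R (c *\<^sub>R \<theta>)) / t) \<longlongrightarrow> dir_growth X (c *\<^sub>R \<theta>)) at_top"
    using assms
    by (intro dir_growth_tendsto rel_interior_convex_cone_scaleR convex_cone_family_cone)
qed simp

lemma ln_word_mult_le_dir_growth:
  assumes "z \<in> family_semigroup X" and "z \<in> rel_interior (family_cone X)"
  shows "ln (real (word_mult X z)) \<le> dir_growth X z"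
proof (rule LIMSEQ_le_const)
  show "(\<lambda>k. log_cone_mult X (real k *\<^sub>R z) / real k) \<longlonglongrightarrow> dir_growth X z"
    using dir_growth_tendsto[OF assms(2)] filterlim_real_sequentially by (rule filterlim_compose)
  have "ln (real (word_mult X z)) \<le> log_cone_mult X (real k *\<^sub>R z) / real k" if "1 \<le> k" for k
  proof -
    have "real (word_mult X z) ^ k \<le> real (cone_mult X (real k *\<^sub>R z))"
      using word_mult_power_le[of z k]
      by (simp add: cone_mult_eq_word_mult family_semigroup_scaleR_of_nat assms(1)
          flip: of_nat_power)
    then have "ln (real (word_mult X z) ^ k) \<le> log_cone_mult X (real k *\<^sub>R z)"
      using word_mult_pos[OF assms(1)] by (intro ln_mono) auto
    then show ?thesis
      using that word_mult_pos[OF assms(1)] by (simp add: ln_realpow le_divide_eq mult.commute)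
  qed
  then show "\<exists>N. \<forall>k\<ge>N. ln (real (word_mult X z)) \<le> log_cone_mult X (real k *\<^sub>R z) / real k"
    by blast
qed

lemma dir_growth_le:
  assumes "exp_sum X b \<le> 1" and "\<theta> \<in> rel_interior (family_cone X)"
  shows "dir_growth X \<theta> \<le> - (b \<bullet> \<theta>)"
proof (rule tendsto_le)
  show "((\<lambda>t. log_cone_mult X (t *\<^sub>R \<theta>) / t) \<longlongrightarrow> dir_growth X \<theta>) at_top"
    using assms(2) by (rule dir_growth_tendsto)
  show "((\<lambda>t. (norm b * total_norm X - b \<bullet> \<theta> * t) / t) \<longlongrightarrow> - (b \<bullet> \<theta>)) at_top"
    by real_asymp
  show "\<forall>\<^sub>F t in at_top. log_cone_mult X (t *\<^sub>R \<theta>) / t \<le> (norm b * total_norm X - b \<bullet> \<theta> * t) / t"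
    using eventually_gt_at_top[of 0]
  proof eventually_elim
    case (elim t)
    then have "t *\<^sub>R \<theta> \<in> family_cone X"
      by (intro scaleR_rel_interior_in_family_cone assms(2)) simp
    then show ?case
      using log_cone_mult_le[OF assms(1), of "t *\<^sub>R \<theta>"] elim
      by (intro divide_right_mono) (simp_all add: mult.commute)
  qed
qed simp

end

subsection \<open>Families with the same growth\<close>

lemma dir_growth_eq_on_rel_interior:
  assumes "half_space_family X" and "half_space_family Y" and "same_dir_growth X Y"
    and "\<theta> \<in> rel_interior (family_cone X)"
  shows "dir_growth X \<theta> = dir_growth Y \<theta>"
proof -
  interpret X: half_space_family X by fact
  interpret Y: half_space_family Y by fact
  have cones: "family_cone X = family_cone Y"
    using assms(3) by (simp add: same_dir_growth_def)
  show ?thesis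
  proof (cases "\<theta> = 0")
    case True
    \<comment> \<open>Homogeneity forces the value \<open>0\<close> at the origin, which \<open>same_dir_growth\<close> does not cover.\<close>
    then show ?thesis
      using X.dir_growth_scaleR[of \<theta> 2] Y.dir_growth_scaleR[of \<theta> 2] assms(4) cones by simp
  next
    case False
    let ?\<theta> = "\<theta> /\<^sub>R norm \<theta>"
    have unit: "?\<theta> \<in> rel_interior (family_cone X)"
      using assms(4) False by (intro rel_interior_convex_cone_scaleR convex_cone_family_cone) auto
    then have "dir_growth X ?\<theta> = dir_growth Y ?\<theta>"
      using assms(3) False rel_interior_subset by (fastforce simp: same_dir_growth_def)
    then have "norm \<theta> * dir_growth X ?\<theta> = norm \<theta> * dir_growth Y ?\<theta>"
      by simp
    then show ?thesis
      using X.dir_growth_scaleR[of ?\<theta> "norm \<theta>"] Y.dir_growth_scaleR[of ?\<theta> "norm \<theta>"]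
        unit cones False by simp
  qed
qed

lemma exp_sum_le_1_if_same_dir_growth:
  assumes "half_space_family X" and "half_space_family Y" and "same_dir_growth X Y"
    and "exp_sum Y b \<le> 1"
  shows "exp_sum X b \<le> 1"
proof -
  interpret X: half_space_family X by fact
  interpret Y: half_space_family Y by fact
  have "real (word_mult X z) * exp (b \<bullet> z) \<le> exp (- (b \<bullet> sum_list X))"
    if "z \<in> family_semigroup X" for z
  proof -
    let ?z = "z + sum_list X"
    have z: "?z \<in> family_semigroup X" "?z \<in> rel_interior (family_cone X)"
      using that family_semigroup_subset_cone
      by (auto intro: family_semigroup_add sum_list_in_family_semigroup
          add_sum_list_in_rel_interior_family_cone)
    have "ln (real (word_mult X z)) \<le> ln (real (word_mult X ?z))"
      using X.word_mult_pos[OF that] X.word_mult_le_add[OF sum_list_in_family_semigroup]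
      by (intro ln_mono) auto
    also have "\<dots> \<le> dir_growth X ?z"
      using z by (rule X.ln_word_mult_le_dir_growth)
    also have "\<dots> = dir_growth Y ?z"
      using assms(1-3) z(2) by (rule dir_growth_eq_on_rel_interior)
    also have "\<dots> \<le> - (b \<bullet> ?z)"
      using assms(3,4) z(2) by (intro Y.dir_growth_le) (simp_all add: same_dir_growth_def)
    finally have "exp (ln (real (word_mult X z)) + b \<bullet> z) \<le> exp (- (b \<bullet> sum_list X))"
      by (simp add: inner_add_right)
    then show ?thesis
      using X.word_mult_pos[OF that] by (simp add: exp_add)
  qed
  then show ?thesis
    by (rule X.exp_sum_le_1_if_word_mult_exp_bounded)
qed

lemma exp_sum_le_if_coplanar_same_dir_growth:
  assumes "half_space_family X" and "half_space_family Y" and "same_dir_growth X Y"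
    and "eta_coplanar \<eta> X" and "eta_coplanar \<eta> Y"
  shows "exp_sum X b \<le> exp_sum Y b"
proof (rule dense_ge)
  fix r assume "exp_sum Y b < r"
  then have "0 < r"
    using exp_sum_nonneg[of Y b] by simp
  have "exp_sum Y (b - ln r *\<^sub>R \<eta>) \<le> 1"
    using assms(5) \<open>exp_sum Y b < r\<close> \<open>0 < r\<close>
    by (simp add: exp_sum_diff_scaleR_coplanar exp_minus divide_le_eq flip: divide_inverse_commute)
  then have "exp_sum X (b - ln r *\<^sub>R \<eta>) \<le> 1"
    by (rule exp_sum_le_1_if_same_dir_growth[OF assms(1-3)])
  then show "exp_sum X b \<le> r"
    using assms(4) \<open>0 < r\<close>
    by (simp add: exp_sum_diff_scaleR_coplanar exp_minus divide_le_eq flip: divide_inverse_commute)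
qed

theorem theorem1p5:
  fixes X Y :: "(real ^ 'n) list" and \<eta> :: "real ^ 'n"
  assumes "admissible_family X" and "admissible_family Y"
    and "eta_coplanar \<eta> X" and "eta_coplanar \<eta> Y"
    and "same_dir_growth X Y"
  shows "length X = length Y \<and> (\<exists>p. p permutes {..<length Y} \<and> X = permute_list p Y)"
proof -
  have families: "half_space_family X" "half_space_family Y"
    using assms(1,2) by (auto simp: admissible_family_def half_space_family_def)
  have "same_dir_growth Y X"
    using assms(5) by (simp add: same_dir_growth_def)
  then have "exp_sum X b = exp_sum Y b" for b
    using families assms(3-5) by (intro antisym exp_sum_le_if_coplanar_same_dir_growth)
  then have "mset X = mset Y"
    by (intro mset_eq_if_exp_sum_eq) auto
  then obtain p where "p permutes {..<length Y}" "permute_list p Y = X"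
    by (rule mset_eq_permutation)
  with \<open>mset X = mset Y\<close> show ?thesis
    by (auto dest: mset_eq_length)
qed

end
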